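(* Let $k\geq 4$ be an integer, and let $L(k)$ denote the smallest integer $n$ such that every $C(k)$-free family of compact, convex sets in the plane can be pierced by $n$ lines. Then \[ \left\lceil \frac{k}{2} \right\rceil\leq L(k)\leq k-2. \]
   Context: For $k\geq 4$, a $C(k)$ is a family of $k$ distinct sets $F_1,\dots,F_k$ in the plane together with this linear ordering, such that $\mathrm{conv}(F_i\cup F_{i+1})\cap \mathrm{conv}(F_j\cup F_{j+1})=\emptyset$ whenever $\{i,i+1\}\cap \{j,j+1\}=\emptyset$, indices taken modulo $k$. A $C(3)$ is a family of three pairwise disjoint sets $F_1,F_2,F_3$ in the plane with $\mathrm{conv}(F_1\cup F_2)\cap \mathrm{conv}(F_2\cup F_3)\cap \mathrm{conv}(F_3\cup F_1)= \emptyset$. A family $\mathcal{F}$ is $C(k)$-free if no subfamily of $\mathcal{F}$ (with some ordering) is a $C(k)$. A family $\mathcal{F}$ of sets is pierced by lines $L_1,\dots,L_n$ if every set in $\mathcal{F}$ meets $L_1\cup\dots\cup L_n$. Families may be infinite. *)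

theory Defs
  imports "HOL-Analysis.Analysis"
begin

type_synonym plane = "real ^ 2"

definition is_line :: "plane set \<Rightarrow> bool" where
  "is_line l \<longleftrightarrow> affine l \<and> aff_dim l = 1"

(* The sequence F 0, ..., F (k - 1) forms a C(k), for k \<ge> 4; the separately defined C(3) is
   not covered. *)
definition is_C :: "nat \<Rightarrow> (nat \<Rightarrow> plane set) \<Rightarrow> bool" where
  "is_C k F \<longleftrightarrow> inj_on F {..<k} \<and>
     (\<forall>i<k. \<forall>j<k. {i, (i + 1) mod k} \<inter> {j, (j + 1) mod k} = {} \<longrightarrow>
        convex hull (F i \<union> F ((i + 1) mod k)) \<inter> convex hull (F j \<union> F ((j + 1) mod k)) = {})"

definition C_free :: "nat \<Rightarrow> plane set set \<Rightarrow> bool" where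
  "C_free k \<F> \<longleftrightarrow> \<not> (\<exists>F. F ` {..<k} \<subseteq> \<F> \<and> is_C k F)"

definition pierced_by :: "plane set set \<Rightarrow> (nat \<Rightarrow> plane set) \<Rightarrow> nat \<Rightarrow> bool" where
  "pierced_by \<F> l n \<longleftrightarrow> (\<forall>S\<in>\<F>. S \<inter> (\<Union>i<n. l i) \<noteq> {})"

(* Nonemptiness is required because a family containing the empty set is not pierced by
   any lines at all. *)
definition lines_suffice :: "nat \<Rightarrow> nat \<Rightarrow> bool" where
  "lines_suffice k n \<longleftrightarrow>
     (\<forall>\<F> :: plane set set.
        (\<forall>S\<in>\<F>. compact S \<and> convex S \<and> S \<noteq> {}) \<longrightarrow> C_free k \<F> \<longrightarrow>
        (\<exists>l. (\<forall>i<n. is_line (l i)) \<and> pierced_by \<F> l n))"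

(* Meaningful only if some number of lines suffices for k. *)
definition L :: "nat \<Rightarrow> nat" where
  "L k = (LEAST n. lines_suffice k n)"

end

(* Upper bound. By compactness of the space of lines together with the line at infinity the family
   may be taken finite. Fix a line l of slope m and height b, and pierce the sets missed by l greedily
   with k - 3 vertical lines; if this fails, the missed sets contain a chain of k - 2 sets separated by
   vertical lines. The height can be chosen so that the leftmost missed set has a partner that
   reaches no further right and lies weakly on the other side of l. It can also be chosen so that the
   same happens at the right end. The two heights depend continuously on m, and their difference has
   opposite signs for steep positive and steep negative slopes, so for some m they agree. The chain
   together with the two partners then forms a C(k): run through the sets above l from left to right
   and return through those below l.

   Lower bound. The members of a C(k) are pairwise disjoint, but any k sides of a convex (2k - 1)-gon
   include two adjacent ones, while a line meets at most 4 sides; hence 2k - 1 <= 4n if n lines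
   suffice. *)
theory Submission
  imports Defs
begin

subsection \<open>Reduction to finite families\<close>

text \<open>Induction on \<open>n\<close>: the finite intersection property in \<open>X\<close>
  gives one point \<open>x0\<close> that can serve as the last point for every finite subfamily at
  once, and the members not served by \<open>x0\<close> fall under the induction hypothesis. Later
  \<open>R S\<close> is the set of lines meeting \<open>S\<close>.\<close>

lemma piercing_compactness:
  fixes R :: "'s \<Rightarrow> 'x::topological_space set"
  assumes X: "compact X"
    and R: "\<And>S. S \<in> \<F> \<Longrightarrow> closed (R S)"
    and fin: "\<And>\<G>. finite \<G> \<Longrightarrow> \<G> \<subseteq> \<F> \<Longrightarrow>
      \<exists>x. (\<forall>i<n::nat. x i \<in> X) \<and> (\<forall>S\<in>\<G>. \<exists>i<n. x i \<in> R S)"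
  shows "\<exists>x. (\<forall>i<n. x i \<in> X) \<and> (\<forall>S\<in>\<F>. \<exists>i<n. x i \<in> R S)"
  using R fin
proof (induction n arbitrary: \<F>)
  case 0
  have "\<F> = {}"
  proof (rule ccontr)
    assume "\<F> \<noteq> {}"
    then obtain S where "S \<in> \<F>" by blast
    with "0.prems"(2)[of "{S}"] show False by simp
  qed
  then show ?case by simp
next
  case (Suc n)
  define P where "P = (\<lambda>\<G>. \<exists>x. (\<forall>i<n. x i \<in> X) \<and> (\<forall>S\<in>\<G>. \<exists>i<n. x i \<in> R S))"
  have P_mono: "P \<H>" if "P \<G>" "\<H> \<subseteq> \<G>" for \<G> \<H>
    using that unfolding P_def by blast
  \<comment> \<open>\<open>Z \<G>\<close> collects the admissible last points for
    \<open>\<G>\<close>. Written as a union over the subfamilies they serve, it is visibly closed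
    when \<open>\<G>\<close> is finite.\<close>
  define Z where "Z = (\<lambda>\<G>. \<Union>\<H>\<in>{\<H>. \<H> \<subseteq> \<G> \<and> P (\<G> - \<H>)}. \<Inter>S\<in>\<H>. R S)"
  have Z_iff: "x \<in> Z \<G> \<longleftrightarrow> P {S \<in> \<G>. x \<notin> R S}" for x \<G>
  proof
    assume "x \<in> Z \<G>"
    then obtain \<H> where "\<H> \<subseteq> \<G>" "P (\<G> - \<H>)" "\<forall>S\<in>\<H>. x \<in> R S" unfolding Z_def by blast
    then show "P {S \<in> \<G>. x \<notin> R S}" by (elim P_mono) blast
  next
    assume *: "P {S \<in> \<G>. x \<notin> R S}"
    have eq: "{S \<in> \<G>. x \<notin> R S} = \<G> - {S \<in> \<G>. x \<in> R S}" by blast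
    show "x \<in> Z \<G>" unfolding Z_def
      by (rule UN_I[of "{S \<in> \<G>. x \<in> R S}"]) (use * eq in auto)
  qed
  let ?\<Z> = "Z ` {\<G>. finite \<G> \<and> \<G> \<subseteq> \<F>}"
  have "X \<inter> \<Inter>?\<Z> \<noteq> {}"
  proof (rule compact_imp_fip[OF X])
    fix T assume "T \<in> ?\<Z>"
    then obtain \<G> where T: "T = Z \<G>" "finite \<G>" "\<G> \<subseteq> \<F>" by blast
    have "finite {\<H>. \<H> \<subseteq> \<G> \<and> P (\<G> - \<H>)}"
      using T(2) by (rule_tac finite_subset[of _ "Pow \<G>"]) auto
    then show "closed T" unfolding T(1) Z_def
      by (rule closed_UN) (use T(3) Suc.prems(1) in \<open>auto intro!: closed_INT\<close>)
  next
    fix \<T> assume "finite \<T>" "\<T> \<subseteq> ?\<Z>"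
    then obtain \<A> where \<A>: "\<A> \<subseteq> {\<G>. finite \<G> \<and> \<G> \<subseteq> \<F>}" "finite \<A>" "\<T> = Z ` \<A>"
      by (meson finite_subset_image)
    then have U: "finite (\<Union>\<A>)" "\<Union>\<A> \<subseteq> \<F>" by auto
    from Suc.prems(2)[OF this] obtain x where
      x: "\<forall>i<Suc n. x i \<in> X" "\<forall>S\<in>\<Union>\<A>. \<exists>i<Suc n. x i \<in> R S" by blast
    \<comment> \<open>A solution for the union of finitely many subfamilies solves each of them, so
      its last point \<open>x n\<close> lies in all the sets \<open>Z \<G>\<close>.\<close>
    have "P {S \<in> \<Union>\<A>. x n \<notin> R S}" unfolding P_def
    proof (rule exI[of _ x], rule conjI)
      show "\<forall>i<n. x i \<in> X" using x(1) by simp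
      show "\<forall>S\<in>{S \<in> \<Union>\<A>. x n \<notin> R S}. \<exists>i<n. x i \<in> R S"
      proof
        fix S assume S: "S \<in> {S \<in> \<Union>\<A>. x n \<notin> R S}"
        with x(2) obtain i where i: "i < Suc n" "x i \<in> R S" by blast
        then have "i \<noteq> n" using S by auto
        then have "i < n" using i(1) by simp
        then show "\<exists>i<n. x i \<in> R S" using i(2) by blast
      qed
    qed
    then have "P {S \<in> \<G>. x n \<notin> R S}" if "\<G> \<in> \<A>" for \<G>
      by (rule P_mono) (use that in blast)
    then have "x n \<in> \<Inter>\<T>" unfolding \<A>(3) by (auto simp: Z_iff)
    moreover have "x n \<in> X" using x(1) by simp
    ultimately show "X \<inter> \<Inter>\<T> \<noteq> {}" by blast
  qed
  then obtain x0 where x0: "x0 \<in> X" "x0 \<in> \<Inter>?\<Z>" by blast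
  have x0_P: "P {S \<in> \<G>. x0 \<notin> R S}" if "finite \<G>" "\<G> \<subseteq> \<F>" for \<G>
    using x0(2) that by (auto simp flip: Z_iff)
  have "\<exists>x. (\<forall>i<n. x i \<in> X) \<and> (\<forall>S\<in>{S \<in> \<F>. x0 \<notin> R S}. \<exists>i<n. x i \<in> R S)"
  proof (rule Suc.IH)
    fix \<G> assume "finite \<G>" "\<G> \<subseteq> {S \<in> \<F>. x0 \<notin> R S}"
    then have "P {S \<in> \<G>. x0 \<notin> R S}" "{S \<in> \<G>. x0 \<notin> R S} = \<G>" using x0_P[of \<G>] by blast+
    then show "\<exists>x. (\<forall>i<n. x i \<in> X) \<and> (\<forall>S\<in>\<G>. \<exists>i<n. x i \<in> R S)"
      unfolding P_def by simp
  qed (use Suc.prems(1) in blast)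
  then obtain x where x: "\<forall>i<n. x i \<in> X" "\<forall>S\<in>\<F>. x0 \<notin> R S \<longrightarrow> (\<exists>i<n. x i \<in> R S)" by blast
  show ?case
  proof (rule exI[of _ "x(n := x0)"], rule conjI)
    show "\<forall>i<Suc n. (x(n := x0)) i \<in> X" using x(1) x0(1) by simp
    show "\<forall>S\<in>\<F>. \<exists>i<Suc n. (x(n := x0)) i \<in> R S"
    proof
      fix S assume S: "S \<in> \<F>"
      show "\<exists>i<Suc n. (x(n := x0)) i \<in> R S"
      proof (cases "x0 \<in> R S")
        case True
        then show ?thesis by (intro exI[of _ n]) simp
      next
        case False
        with x(2) S obtain i where "i < n" "x i \<in> R S" by blast
        then show ?thesis by (intro exI[of _ i]) simp
      qed
    qed
  qed
qed

subsection \<open>Piercing finite families\<close>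

text \<open>Greedy choice: put a point at the smallest right end \<open>r G\<close>. The intervals
  it misses begin strictly beyond it, so a chain among them can be extended by \<open>G\<close> in
  front.\<close>

lemma interval_piercing_or_chain:
  fixes l r :: "'s \<Rightarrow> real"
  assumes "finite U" "\<And>G. G \<in> U \<Longrightarrow> l G \<le> r G"
  shows "(\<exists>c. \<forall>G\<in>U. \<exists>i<n::nat. l G \<le> c i \<and> c i \<le> r G) \<or>
    (\<exists>Gs. length Gs = Suc n \<and> set Gs \<subseteq> U \<and> sorted_wrt (\<lambda>G H. r G < l H) Gs)"
  using assms
proof (induction n arbitrary: U)
  case 0
  show ?case
  proof (cases "U = {}")
    case False
    then obtain G where "G \<in> U" by blast
    then show ?thesis by (intro disjI2 exI[of _ "[G]"]) simp
  qed simp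
next
  case (Suc n)
  show ?case
  proof (cases "U = {}")
    case False
    then obtain G where G: "G \<in> U" "\<And>H. H \<in> U \<Longrightarrow> r G \<le> r H"
      using Suc.prems(1) ex_min_if_finite[of "r ` U"] by (metis arg_min_if_finite(1) arg_min_least)
    let ?V = "{H \<in> U. r G < l H}"
    from Suc.IH[of ?V] Suc.prems consider
      (pierced) c where "\<forall>H\<in>?V. \<exists>i<n. l H \<le> c i \<and> c i \<le> r H" |
      (chain) Gs where "length Gs = Suc n" "set Gs \<subseteq> ?V" "sorted_wrt (\<lambda>G H. r G < l H) Gs"
      by auto
    then show ?thesis
    proof cases
      case pierced
      have "\<exists>i<Suc n. l H \<le> (c(n := r G)) i \<and> (c(n := r G)) i \<le> r H" if H: "H \<in> U" for H
      proof (cases "r G < l H")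
        case True
        then obtain i where "i < n" "l H \<le> c i" "c i \<le> r H" using pierced H by blast
        then show ?thesis by (intro exI[of _ i]) simp
      next
        case False
        then show ?thesis using G(2)[OF H] by (intro exI[of _ n]) simp
      qed
      then show ?thesis by blast
    next
      case chain
      then show ?thesis using G(1) by (intro disjI2 exI[of _ "G # Gs"]) auto
    qed
  qed simp
qed

text \<open>The largest height \<open>b\<close> at which some \<open>G\<close> lies weakly above \<open>b\<close> and no \<open>H\<close> with
  \<open>\<kappa> H \<le> \<kappa> G\<close> lies strictly below \<open>b\<close>, where a set occupies the heights from \<open>p\<close> to \<open>q\<close>. Being a
  finite max-min it varies continuously with \<open>p\<close> and \<open>q\<close>.\<close>
definition balance :: "'s set \<Rightarrow> ('s \<Rightarrow> real) \<Rightarrow> ('s \<Rightarrow> real) \<Rightarrow> ('s \<Rightarrow> real) \<Rightarrow> real" where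
  "balance \<F> \<kappa> p q = Max ((\<lambda>G. Min ((\<lambda>H. min (p G) (q H)) ` {H \<in> \<F>. \<kappa> H \<le> \<kappa> G})) ` \<F>)"

context
  fixes \<F> :: "'s set" and \<kappa> p q :: "'s \<Rightarrow> real"
  assumes fin: "finite \<F>" and ne: "\<F> \<noteq> {}"
begin

text \<open>This equivalence, its companion below and continuity are all that is used of the max-min
  formula.\<close>

lemma balance_ge_iff:
  "c \<le> balance \<F> \<kappa> p q \<longleftrightarrow> (\<exists>G\<in>\<F>. c \<le> p G \<and> (\<forall>H\<in>\<F>. \<kappa> H \<le> \<kappa> G \<longrightarrow> c \<le> q H))"
proof -
  have "c \<le> Min ((\<lambda>H. min (p G) (q H)) ` {H \<in> \<F>. \<kappa> H \<le> \<kappa> G}) \<longleftrightarrow>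
      c \<le> p G \<and> (\<forall>H\<in>\<F>. \<kappa> H \<le> \<kappa> G \<longrightarrow> c \<le> q H)" if "G \<in> \<F>" for G
    using that fin by (subst Min_ge_iff) auto
  then show ?thesis unfolding balance_def using fin ne by (subst Max_ge_iff) auto
qed

lemma balance_le_iff:
  "balance \<F> \<kappa> p q \<le> c \<longleftrightarrow> (\<forall>G\<in>\<F>. p G \<le> c \<or> (\<exists>H\<in>\<F>. \<kappa> H \<le> \<kappa> G \<and> q H \<le> c))"
proof -
  have "Min ((\<lambda>H. min (p G) (q H)) ` {H \<in> \<F>. \<kappa> H \<le> \<kappa> G}) \<le> c \<longleftrightarrow>
      p G \<le> c \<or> (\<exists>H\<in>\<F>. \<kappa> H \<le> \<kappa> G \<and> q H \<le> c)" if "G \<in> \<F>" for G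
    using that fin by (subst Min_le_iff) (auto simp: min_le_iff_disj)
  then show ?thesis unfolding balance_def using fin ne by (subst Max_le_iff) auto
qed

end

lemma continuous_on_Max_image:
  fixes f :: "'s \<Rightarrow> 'x::topological_space \<Rightarrow> real"
  assumes "finite A" "A \<noteq> {}" "\<And>a. a \<in> A \<Longrightarrow> continuous_on X (f a)"
  shows "continuous_on X (\<lambda>x. Max ((\<lambda>a. f a x) ` A))"
  using assms by (induction A rule: finite_ne_induct) (auto intro!: continuous_on_max)

lemma continuous_on_Min_image:
  fixes f :: "'s \<Rightarrow> 'x::topological_space \<Rightarrow> real"
  assumes "finite A" "A \<noteq> {}" "\<And>a. a \<in> A \<Longrightarrow> continuous_on X (f a)"
  shows "continuous_on X (\<lambda>x. Min ((\<lambda>a. f a x) ` A))"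
  using assms by (induction A rule: finite_ne_induct) (auto intro!: continuous_on_min)

lemma continuous_on_balance:
  fixes p q :: "'s \<Rightarrow> 'x::topological_space \<Rightarrow> real"
  assumes "finite \<F>" "\<F> \<noteq> {}"
    and "\<And>S. S \<in> \<F> \<Longrightarrow> continuous_on X (p S)" "\<And>S. S \<in> \<F> \<Longrightarrow> continuous_on X (q S)"
  shows "continuous_on X (\<lambda>x. balance \<F> \<kappa> (\<lambda>S. p S x) (\<lambda>S. q S x))"
  unfolding balance_def using assms
  by (intro continuous_on_Max_image continuous_on_Min_image continuous_on_min) auto

section \<open>Extents of a compact set in a given direction\<close>

definition mn :: "'a::real_inner \<Rightarrow> 'a set \<Rightarrow> real" where
  "mn a S = (INF x\<in>S. a \<bullet> x)"

definition mx :: "'a::real_inner \<Rightarrow> 'a set \<Rightarrow> real" where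
  "mx a S = (SUP x\<in>S. a \<bullet> x)"

lemma compact_inner_image: "compact S \<Longrightarrow> compact ((\<bullet>) a ` S)"
  by (intro compact_continuous_image continuous_intros)

lemma mn_attained: "compact S \<Longrightarrow> S \<noteq> {} \<Longrightarrow> \<exists>x\<in>S. a \<bullet> x = mn a S"
  using closed_contains_Inf[of "(\<bullet>) a ` S"] compact_inner_image[of S a]
  by (force simp: mn_def intro: compact_imp_closed bounded_imp_bdd_below compact_imp_bounded)

lemma mx_attained: "compact S \<Longrightarrow> S \<noteq> {} \<Longrightarrow> \<exists>x\<in>S. a \<bullet> x = mx a S"
  using closed_contains_Sup[of "(\<bullet>) a ` S"] compact_inner_image[of S a]
  by (force simp: mx_def intro: compact_imp_closed bounded_imp_bdd_above compact_imp_bounded)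

lemma mn_le: "compact S \<Longrightarrow> x \<in> S \<Longrightarrow> mn a S \<le> a \<bullet> x"
  unfolding mn_def
  by (intro cINF_lower bounded_imp_bdd_below compact_imp_bounded compact_inner_image)

lemma le_mx: "compact S \<Longrightarrow> x \<in> S \<Longrightarrow> a \<bullet> x \<le> mx a S"
  unfolding mx_def
  by (intro cSUP_upper bounded_imp_bdd_above compact_imp_bounded compact_inner_image)

lemma mn_le_mx: "compact S \<Longrightarrow> S \<noteq> {} \<Longrightarrow> mn a S \<le> mx a S"
  by (metis mn_attained le_mx)

lemma hyperplane_meets:
  fixes S :: "'a::real_inner set"
  assumes "compact S" "convex S" "S \<noteq> {}" "mn a S \<le> c" "c \<le> mx a S"
  shows "\<exists>x\<in>S. a \<bullet> x = c"
proof -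
  obtain x y where "x \<in> S" "a \<bullet> x = mn a S" "y \<in> S" "a \<bullet> y = mx a S"
    using mn_attained mx_attained assms by metis
  then show ?thesis
    using connected_ivt_hyperplane[of S x y a c] assms convex_connected by auto
qed

text \<open>Testing both functionals at a minimiser for one of them, Cauchy-Schwarz bounds the
  difference from one side; exchanging the directions gives the other. This makes the extents
  Lipschitz in the direction, hence continuous in the slope.\<close>

lemma abs_mn_diff_le:
  assumes "compact S" "S \<noteq> {}" "\<And>x. x \<in> S \<Longrightarrow> norm x \<le> B"
  shows "\<bar>mn a S - mn a' S\<bar> \<le> B * norm (a - a')"
proof -
  have *: "mn a S - mn a' S \<le> B * norm (a - a')" for a a'
  proof -
    obtain x where x: "x \<in> S" "a' \<bullet> x = mn a' S" using mn_attained assms by metis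
    have "mn a S - mn a' S \<le> (a - a') \<bullet> x"
      using mn_le[OF assms(1) x(1), of a] x(2) by (simp add: inner_diff_left)
    also have "\<dots> \<le> norm (a - a') * norm x" by (rule norm_cauchy_schwarz)
    also have "\<dots> \<le> norm (a - a') * B" by (intro mult_left_mono assms x) auto
    finally show ?thesis by (simp add: mult.commute)
  qed
  show ?thesis using *[of a a'] *[of a' a] by (simp add: norm_minus_commute)
qed

lemma mx_eq_mn: "mx a S = - mn (- a) S"
  unfolding mx_def mn_def by (simp add: Inf_real_def image_image)

lemma continuous_on_mn:
  assumes "compact S" "S \<noteq> {}" "continuous_on X f"
  shows "continuous_on X (\<lambda>t. mn (f t) S)"
proof -
  obtain B where B: "B > 0" "\<And>x. x \<in> S \<Longrightarrow> norm x \<le> B"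
    using compact_imp_bounded[OF assms(1)] bounded_pos by metis
  have "\<bar>mn a S - mn a' S\<bar> \<le> B * norm (a - a')" for a a'
    using abs_mn_diff_le assms B by blast
  then have "B-lipschitz_on UNIV (\<lambda>a. mn a S)"
    using B by (intro lipschitz_onI) (auto simp: dist_norm)
  then have "continuous_on UNIV (\<lambda>a. mn a S)" by (rule lipschitz_on_continuous_on)
  then show ?thesis using continuous_on_compose2 assms(3) by blast
qed

lemma continuous_on_mx:
  assumes "compact S" "S \<noteq> {}" "continuous_on X f"
  shows "continuous_on X (\<lambda>t. mx (f t) S)"
  unfolding mx_eq_mn by (intro continuous_intros continuous_on_mn assms)

text \<open>\<open>S\<close> misses the line at height \<open>b\<close> and serves as one of the two
  partners, which gives the strict inequality. If \<open>S\<close> is above, the upper bound on the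
  balance supplies a \<open>v\<close>; if \<open>S\<close> is below, the member attaining the
  balance must have a smaller key than \<open>S\<close> and serves as \<open>u\<close>.\<close>

lemma balance_partners:
  fixes \<kappa> p q :: "'s \<Rightarrow> real"
  assumes "finite \<F>" "S \<in> \<F>"
    and b: "balance \<F> \<kappa> p q = b" and S: "p S > b \<or> q S < b"
  shows "\<exists>u\<in>\<F>. \<exists>v\<in>\<F>. \<kappa> u \<le> \<kappa> S \<and> \<kappa> v \<le> \<kappa> S \<and>
    b \<le> p u \<and> q v \<le> b \<and> (b < p u \<or> q v < b)"
proof -
  have ne: "\<F> \<noteq> {}" using assms by blast
  have lower: "p G \<le> b \<or> (\<exists>H\<in>\<F>. \<kappa> H \<le> \<kappa> G \<and> q H \<le> b)" if "G \<in> \<F>" for G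
    using balance_le_iff[OF assms(1) ne, of \<kappa> p q b] b that by simp
  obtain G where G: "G \<in> \<F>" "b \<le> p G" "\<And>H. H \<in> \<F> \<Longrightarrow> \<kappa> H \<le> \<kappa> G \<Longrightarrow> b \<le> q H"
    using balance_ge_iff[OF assms(1) ne, of b \<kappa> p q] b by auto
  from S show ?thesis
  proof
    assume "p S > b"
    with lower[OF assms(2)] show ?thesis using assms(2) by (force intro: less_imp_le)
  next
    assume "q S < b"
    then have "\<kappa> G \<le> \<kappa> S" using G(3)[OF assms(2)] by linarith
    then show ?thesis using G \<open>q S < b\<close> assms(2) by (force intro: less_imp_le)
  qed
qed

section \<open>Lines of varying slope and the choice of a balanced one\<close>

abbreviation e1 :: plane where "e1 \<equiv> axis 1 1"

text \<open>The second coordinate is normalised to 1, so that offsets along this normal are the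
  heights at which lines of slope \<open>m\<close> cross the vertical axis.\<close>

definition slope_normal :: "real \<Rightarrow> plane" where
  "slope_normal m = axis 2 1 - m *\<^sub>R e1"

lemma inner_slope_normal: "slope_normal m \<bullet> x = x $ 2 - m * (e1 \<bullet> x)"
  by (simp add: slope_normal_def inner_diff_left inner_axis')

lemma slope_normal_nonzero: "slope_normal m \<noteq> 0"
proof
  assume "slope_normal m = 0"
  then have "slope_normal m $ 2 = 0" by simp
  then show False by (simp add: slope_normal_def axis_def)
qed

text \<open>Intermediate value theorem in \<open>m\<close>. At a steep negative slope, height mostly
  measures position to the right, so the balance from the left end is the lower one; at a steep
  positive slope the order is reversed. The separated pair \<open>G\<close>, \<open>H\<close>
  provides the horizontal gap that makes this work.\<close>

lemma balanced_slope:
  assumes fin: "finite \<F>" and cpt: "\<And>S. S \<in> \<F> \<Longrightarrow> compact S \<and> S \<noteq> {}"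
    and GH: "G \<in> \<F>" "H \<in> \<F>" "mx e1 G < mn e1 H"
  shows "\<exists>m. balance \<F> (mx e1) (mn (slope_normal m)) (mx (slope_normal m)) =
    balance \<F> (\<lambda>S. - mn e1 S) (mn (slope_normal m)) (mx (slope_normal m))"
proof -
  have ne: "\<F> \<noteq> {}" using GH by blast
  let ?p = "\<lambda>m. mn (slope_normal m)" and ?q = "\<lambda>m. mx (slope_normal m)"
  let ?f = "\<lambda>m. balance \<F> (mx e1) (?p m) (?q m)"
  let ?g = "\<lambda>m. balance \<F> (\<lambda>S. - mn e1 S) (?p m) (?q m)"
  have pq: "?p m S \<le> ?q m S" if "S \<in> \<F>" for m S using that cpt mn_le_mx by blast
  obtain G0 where G0: "G0 \<in> \<F>" "\<And>S. S \<in> \<F> \<Longrightarrow> mx e1 G0 \<le> mx e1 S"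
    using arg_min_if_finite(1)[OF fin ne] arg_min_least[OF fin ne] by metis
  obtain H0 where H0: "H0 \<in> \<F>" "\<And>S. S \<in> \<F> \<Longrightarrow> - mn e1 H0 \<le> - mn e1 S"
    using arg_min_if_finite(1)[OF fin ne] arg_min_least[OF fin ne, of _ "\<lambda>S. - mn e1 S"] by metis
  define \<delta> where "\<delta> = mn e1 H0 - mx e1 G0"
  have "\<delta> > 0" unfolding \<delta>_def using G0(2)[OF GH(1)] H0(2)[OF GH(2)] GH(3) by linarith
  have "compact (\<Union>\<F>)" by (rule compact_Union[OF fin]) (simp add: cpt)
  then obtain Y where Y: "Y > 0" "\<And>x. x \<in> \<Union>\<F> \<Longrightarrow> norm x \<le> Y"
    using compact_imp_bounded bounded_pos by metis
  have Y2: "\<bar>x $ 2\<bar> \<le> Y" if "x \<in> S" "S \<in> \<F>" for x S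
  proof -
    have "x \<in> \<Union>\<F>" using that by blast
    then show ?thesis using Y(2)[of x] component_le_norm_cart[of x 2] by linarith
  qed
  \<comment> \<open>Over the horizontal gap \<open>\<delta>\<close> the slope \<open>s\<close> gains
    \<open>2 * Y\<close>, which outweighs all differences between second coordinates.\<close>
  define s where "s = 2 * Y / \<delta>"
  have s: "s > 0" "s * \<delta> = 2 * Y" using Y \<open>\<delta> > 0\<close> by (auto simp: s_def)
  have bounds:
    "?q (- s) S \<le> Y + s * mx e1 S" "s * mn e1 S - Y \<le> ?p (- s) S"
    "- Y - s * mx e1 S \<le> ?p s S" "?q s S \<le> Y - s * mn e1 S" if S: "S \<in> \<F>" for S
  proof -
    have *: "s * mn e1 S \<le> s * (e1 \<bullet> x)" "s * (e1 \<bullet> x) \<le> s * mx e1 S" "\<bar>x $ 2\<bar> \<le> Y" if "x \<in> S" for x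
      using mn_le[of S x e1] le_mx[of S x e1] cpt[OF S] that S s(1) Y2 by auto
    have upper: "\<exists>x\<in>S. ?q t S = x $ 2 - t * (e1 \<bullet> x)" for t
      using mx_attained[of S "slope_normal t"] cpt[OF S] by (metis inner_slope_normal)
    have lower: "\<exists>x\<in>S. ?p t S = x $ 2 - t * (e1 \<bullet> x)" for t
      using mn_attained[of S "slope_normal t"] cpt[OF S] by (metis inner_slope_normal)
    obtain x where x: "x \<in> S" "?q (- s) S = x $ 2 - (- s) * (e1 \<bullet> x)" using upper by blast
    show "?q (- s) S \<le> Y + s * mx e1 S" using x(2) *[OF x(1)] by linarith
    obtain x where x: "x \<in> S" "?q s S = x $ 2 - s * (e1 \<bullet> x)" using upper by blast
    show "?q s S \<le> Y - s * mn e1 S" using x(2) *[OF x(1)] by linarith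
    obtain x where x: "x \<in> S" "?p (- s) S = x $ 2 - (- s) * (e1 \<bullet> x)" using lower by blast
    show "s * mn e1 S - Y \<le> ?p (- s) S" using x(2) *[OF x(1)] by linarith
    obtain x where x: "x \<in> S" "?p s S = x $ 2 - s * (e1 \<bullet> x)" using lower by blast
    show "- Y - s * mx e1 S \<le> ?p s S" using x(2) *[OF x(1)] by linarith
  qed
  have s\<delta>: "s * mn e1 H0 - s * mx e1 G0 = 2 * Y" using s(2) by (simp add: \<delta>_def algebra_simps)
  \<comment> \<open>\<open>G0\<close> has the smallest key, so it is an admissible \<open>H\<close>
    for every member and caps the left balance. Dually, \<open>H0\<close> taken as the member
    \<open>G\<close> bounds the right balance from below.\<close>
  have "?f (- s) \<le> ?q (- s) G0"
    by (subst balance_le_iff[OF fin ne]) (use G0 in blast)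
  also have "\<dots> \<le> s * mn e1 H0 - Y" using bounds(1)[OF G0(1)] s\<delta> by linarith
  also have "\<dots> \<le> ?g (- s)"
  proof (subst balance_ge_iff[OF fin ne], intro bexI[of _ H0] conjI ballI impI)
    fix S assume S: "S \<in> \<F>" "- mn e1 S \<le> - mn e1 H0"
    then have "s * mn e1 H0 \<le> s * mn e1 S" using s(1) by auto
    then show "s * mn e1 H0 - Y \<le> ?q (- s) S" using bounds(2)[OF S(1)] pq[OF S(1), of "- s"] by linarith
  qed (use H0 bounds in auto)
  finally have neg: "?f (- s) - ?g (- s) \<le> 0" by simp
  have "?g s \<le> ?q s H0"
    by (subst balance_le_iff[OF fin ne]) (use H0 in blast)
  also have "\<dots> \<le> - Y - s * mx e1 G0" using bounds(4)[OF H0(1)] s\<delta> by linarith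
  also have "\<dots> \<le> ?f s"
  proof (subst balance_ge_iff[OF fin ne], intro bexI[of _ G0] conjI ballI impI)
    fix S assume S: "S \<in> \<F>" "mx e1 S \<le> mx e1 G0"
    then have "s * mx e1 S \<le> s * mx e1 G0" using s(1) by auto
    then show "- Y - s * mx e1 G0 \<le> ?q s S" using bounds(3)[OF S(1)] pq[OF S(1), of s] by linarith
  qed (use G0 bounds in auto)
  finally have pos: "0 \<le> ?f s - ?g s" by simp
  have "continuous_on {- s..s} (\<lambda>m. ?f m - ?g m)"
    using cpt unfolding slope_normal_def
    by (intro continuous_intros continuous_on_balance continuous_on_mn continuous_on_mx fin ne) auto
  then obtain m where "?f m - ?g m = 0" using IVT'[of "\<lambda>m. ?f m - ?g m" "- s" 0 s] neg pos s(1) by auto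
  then show ?thesis by auto
qed

section \<open>Convex separation and the construction of a C(k)\<close>

lemma convex_lexicographic_halfspace:
  fixes a :: "'a::real_inner"
  assumes "convex T"
  shows "convex ({x. a \<bullet> x > b} \<union> {x. a \<bullet> x = b} \<inter> T)"
proof (rule convexI)
  fix x y and u v :: real
  assume xy: "x \<in> {x. a \<bullet> x > b} \<union> {x. a \<bullet> x = b} \<inter> T" "y \<in> {x. a \<bullet> x > b} \<union> {x. a \<bullet> x = b} \<inter> T"
    and uv: "0 \<le> u" "0 \<le> v" "u + v = 1"
  \<comment> \<open>The excess over \<open>b\<close> is averaged. With positive weights it vanishes
    only if both points lie on the boundary, where convexity of \<open>T\<close> decides.\<close>
  have eq: "a \<bullet> (u *\<^sub>R x + v *\<^sub>R y) - b = u * (a \<bullet> x - b) + v * (a \<bullet> y - b)"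
    using uv(3) by (simp add: inner_add_right algebra_simps flip: distrib_left)
  show "u *\<^sub>R x + v *\<^sub>R y \<in> {x. a \<bullet> x > b} \<union> {x. a \<bullet> x = b} \<inter> T"
  proof (cases "u = 0 \<or> v = 0")
    case True
    then show ?thesis using xy uv by auto
  next
    case False
    then have pos: "u > 0" "v > 0" using uv by auto
    have ge: "a \<bullet> x - b \<ge> 0" "a \<bullet> y - b \<ge> 0" using xy by auto
    show ?thesis
    proof (cases "a \<bullet> x = b \<and> a \<bullet> y = b")
      case True
      then have "x \<in> T" "y \<in> T" using xy by auto
      then have "u *\<^sub>R x + v *\<^sub>R y \<in> T" using convexD[OF assms] uv by blast
      then show ?thesis using eq True by simp
    next
      case False
      then have "u * (a \<bullet> x - b) + v * (a \<bullet> y - b) > 0"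
        using pos ge by (metis add_nonneg_pos add_pos_nonneg less_eq_real_def mult_nonneg_nonneg
          mult_pos_pos right_minus_eq uv(1,2))
      then show ?thesis using eq by auto
    qed
  qed
qed

lemma hulls_disjoint_if_between:
  assumes "\<And>S. S \<in> {A, B, C, D} \<Longrightarrow> compact S"
    and "mx a A < mn a C" "mx a A < mn a D" "mx a B < mn a C" "mx a B < mn a D"
  shows "convex hull (A \<union> B) \<inter> convex hull (C \<union> D) = {}"
proof -
  define c where "c = max (mx a A) (mx a B)"
  have c: "mx a A \<le> c" "mx a B \<le> c" "c < mn a C" "c < mn a D" using assms(2-) by (auto simp: c_def)
  have cpt: "compact A" "compact B" "compact C" "compact D" by (simp_all add: assms(1))
  have "A \<union> B \<subseteq> {x. a \<bullet> x \<le> c}"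
  proof
    fix x assume "x \<in> A \<union> B"
    then have "a \<bullet> x \<le> mx a A \<or> a \<bullet> x \<le> mx a B"
      using le_mx[OF cpt(1), of x a] le_mx[OF cpt(2), of x a] by blast
    then show "x \<in> {x. a \<bullet> x \<le> c}" using c by auto
  qed
  then have "convex hull (A \<union> B) \<subseteq> {x. a \<bullet> x \<le> c}"
    by (intro hull_minimal convex_halfspace_le)
  moreover have "C \<union> D \<subseteq> {x. a \<bullet> x > c}"
  proof
    fix x assume "x \<in> C \<union> D"
    then have "mn a C \<le> a \<bullet> x \<or> mn a D \<le> a \<bullet> x"
      using mn_le[OF cpt(3), of x a] mn_le[OF cpt(4), of x a] by blast
    then show "x \<in> {x. a \<bullet> x > c}" using c by auto
  qed
  then have "convex hull (C \<union> D) \<subseteq> {x. a \<bullet> x > c}"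
    by (intro hull_minimal convex_halfspace_gt)
  moreover have "{x. a \<bullet> x \<le> c} \<inter> {x. a \<bullet> x > c} = {}" by auto
  ultimately show ?thesis by blast
qed

text \<open>The cyclic order runs through \<open>us\<close> from left to right and back through \<open>vs\<close>: two edges within
  one chain, or an edge joining the chains, are separated by a line orthogonal to \<open>a\<close>, and edges of
  different chains by \<open>Up\<close> and \<open>Down\<close>.\<close>
lemma two_chains_is_C:
  fixes us vs :: "plane set list"
  assumes cpt: "\<And>S. S \<in> set us \<union> set vs \<Longrightarrow> compact S \<and> S \<noteq> {}"
    and Up: "convex Up" "\<And>S. S \<in> set us \<Longrightarrow> S \<subseteq> Up"
    and Down: "convex Down" "\<And>S. S \<in> set vs \<Longrightarrow> S \<subseteq> Down"
    and disj: "Up \<inter> Down = {}"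
    and us: "sorted_wrt (\<lambda>A B. mx a A < mn a B) us" "length us = Suc (Suc p)"
    and vs: "sorted_wrt (\<lambda>A B. mx a A < mn a B) vs" "length vs = Suc (Suc q)"
    and first: "\<And>i. i \<le> q \<Longrightarrow> mx a (us ! 0) < mn a (vs ! Suc i)"
      "\<And>i. i \<le> p \<Longrightarrow> mx a (vs ! 0) < mn a (us ! Suc i)"
    and last: "\<And>i. i \<le> q \<Longrightarrow> mx a (vs ! i) < mn a (us ! Suc p)"
      "\<And>i. i \<le> p \<Longrightarrow> mx a (us ! i) < mn a (vs ! Suc q)"
  shows "is_C (length us + length vs) ((!) (us @ rev vs))"
proof -
  define k where "k = length us + length vs"
  define F where "F = (!) (us @ rev vs)"
  have k: "k = p + q + 4" using us vs by (simp add: k_def)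
  have Fu: "F i = us ! i" if "i \<le> Suc p" for i using that us by (simp add: F_def nth_append)
  \<comment> \<open>From position \<open>p + 2\<close> on, \<open>vs\<close> is listed backwards and
    ends with \<open>vs ! 0\<close> at position \<open>k - 1 = p + q + 3\<close>.\<close>
  have Fv: "F i = vs ! (p + q + 3 - i)" if "p + 2 \<le> i" "i < k" for i
    using that us vs k by (simp add: F_def nth_append rev_nth Suc_diff_le) (auto intro!: arg_cong[of _ _ "(!) vs"])
  have u: "mx a (us ! i) < mn a (us ! j)" if "i < j" "j \<le> Suc p" for i j
    using us that by (auto simp: sorted_wrt_iff_nth_less)
  have v: "mx a (vs ! i) < mn a (vs ! j)" if "i < j" "j \<le> Suc q" for i j
    using vs that by (auto simp: sorted_wrt_iff_nth_less)
  have cF: "compact (F i) \<and> F i \<noteq> {}" if "i < k" for i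
    using that cpt nth_mem[of i "us @ rev vs"] by (auto simp: F_def k_def simp del: nth_mem)
  have UpF: "F i \<subseteq> Up" if "i \<le> Suc p" for i
    using Up(2) that us(2) by (simp add: Fu)
  have DownF: "F i \<subseteq> Down" if "p + 2 \<le> i" "i < k" for i
    using Down(2) that vs(2) k by (simp add: Fv)
  have hulls: "convex hull (F i \<union> F (Suc i mod k)) \<inter> convex hull (F j \<union> F (Suc j mod k)) = {}"
    if ij: "i < j" "j < k" and d: "{i, Suc i mod k} \<inter> {j, Suc j mod k} = {}" for i j
  proof -
    have Si: "Suc i mod k = Suc i" using ij by simp
    have ij': "Suc i < j" using d ij Si by (cases "Suc i = j") auto
    have Sj: "Suc j mod k = (if j = k - 1 then 0 else Suc j)" using ij by auto
    have j0: "j = k - 1 \<Longrightarrow> i > 0" using d Sj by (cases i) auto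
    have sep: ?thesis if "mx a (F i) < mn a (F j)" "mx a (F i) < mn a (F (Suc j mod k))"
      "mx a (F (Suc i)) < mn a (F j)" "mx a (F (Suc i)) < mn a (F (Suc j mod k))"
      unfolding Si using cF that ij ij' by (intro hulls_disjoint_if_between[where a = a]) auto
    \<comment> \<open>The mirrored orientation serves the returning half, where later sets lie
      further left.\<close>
    have sep': ?thesis if "mx a (F j) < mn a (F i)" "mx a (F (Suc j mod k)) < mn a (F i)"
      "mx a (F j) < mn a (F (Suc i))" "mx a (F (Suc j mod k)) < mn a (F (Suc i))"
    proof -
      have "convex hull (F j \<union> F (Suc j mod k)) \<inter> convex hull (F i \<union> F (Suc i)) = {}"
        using cF that ij ij' by (intro hulls_disjoint_if_between[where a = a]) auto
      then show ?thesis unfolding Si by blast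
    qed
    show ?thesis
    proof (cases "j = k - 1")
      case True
      have j: "F j = vs ! 0" "F (Suc j mod k) = us ! 0"
        using True k Fv[of j] Fu[of 0] Sj by auto
      \<comment> \<open>The closing edge joins the two leftmost sets; both lie to the left of every
        other member.\<close>
      have *: "mx a (vs ! 0) < mn a (F n) \<and> mx a (us ! 0) < mn a (F n)" if n: "0 < n" "n < k - 1" for n
      proof (cases "n \<le> Suc p")
        case True
        then obtain n' where "n = Suc n'" "n' \<le> p" using n by (cases n) auto
        then show ?thesis using u[of 0 n] first(2)[of n'] True by (simp add: Fu)
      next
        case False
        obtain n' where n': "p + q + 3 - n = Suc n'" "n' \<le> q"
          using n k False by (intro that[of "p + q + 2 - n"]) auto
        have "F n = vs ! Suc n'" using Fv[of n] False n k n'(1) by simp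
        then show ?thesis using v[of 0 "Suc n'"] first(1)[of n'] n'(2) by simp
      qed
      show ?thesis by (rule sep') (use *[of i] *[of "Suc i"] j j0 True ij' ij in auto)
    next
      case False
      then have j: "Suc j mod k = Suc j" "Suc j < k" using ij Sj by auto
      \<comment> \<open>In order: both edges within \<open>us\<close>; the edge at \<open>j\<close>
        crosses over at the right end; one edge in each chain; the edge at \<open>i\<close> crosses
        over; both edges within \<open>vs\<close>. Only the third case needs \<open>Up\<close> and
        \<open>Down\<close>.\<close>
      consider "j \<le> p" | "j = Suc p" | "i \<le> p" "p + 2 \<le> j" | "i = Suc p" | "p + 2 \<le> i"
        by linarith
      then show ?thesis
      proof cases
        case 1
        then show ?thesis using u ij' by (intro sep) (auto simp: Fu j)
      next
        case 2
        have eqs: "F (Suc j mod k) = vs ! Suc q" "F j = us ! Suc p" "F i = us ! i" "F (Suc i) = us ! Suc i"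
          using Fv[of "Suc j"] Fu[of j] Fu[of i] Fu[of "Suc i"] 2 k ij' unfolding j(1) by simp_all
        have "i < Suc p" "Suc i < Suc p" "i \<le> p" "Suc i \<le> p" using ij' 2 by simp_all
        note ineqs = u[OF this(1) order_refl] u[OF this(2) order_refl] last(2)[OF this(3)] last(2)[OF this(4)]
        show ?thesis by (rule sep) (simp_all only: eqs ineqs)
      next
        case 3
        have "convex hull (F i \<union> F (Suc i)) \<subseteq> Up"
          using UpF 3 Up(1) by (intro hull_minimal) auto
        moreover have "convex hull (F j \<union> F (Suc j)) \<subseteq> Down"
          using DownF 3 Down(1) j by (intro hull_minimal) auto
        ultimately show ?thesis using disj j Si by auto
      next
        case 4
        have "F (Suc i) = vs ! Suc q" "F i = us ! Suc p" using Fu[of i] Fv[of "Suc i"] 4 k by simp_all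
        moreover have "mx a (F n) < mn a (us ! Suc p) \<and> mx a (F n) < mn a (vs ! Suc q)"
          if "n > p + 2" "n < k" for n
          using Fv[of n] that last(1)[of "p + q + 3 - n"] v[of "p + q + 3 - n" "Suc q"] k by auto
        ultimately show ?thesis using ij' 4 j ij by (intro sep') auto
      next
        case 5
        then show ?thesis using v ij' j ij k by (intro sep') (auto simp: Fv)
      qed
    qed
  qed
  have "inj_on F {..<k}"
  proof (rule linorder_inj_onI)
    fix i j assume ij: "i < j" "i \<in> {..<k}" "j \<in> {..<k}"
    then have c: "compact (F i)" "F i \<noteq> {}" "compact (F j)" "F j \<noteq> {}" using cF by auto
    consider "j \<le> Suc p" | "i \<le> Suc p" "p + 2 \<le> j" | "p + 2 \<le> i" by linarith
    then show "F i \<noteq> F j"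
    proof cases
      case 1
      then have "mx a (F i) < mn a (F j)" using u ij by (simp add: Fu)
      then show ?thesis using mn_le_mx[OF c(1,2), of a] by auto
    next
      case 2
      then show ?thesis using UpF[of i] DownF[of j] disj c ij by auto
    next
      case 3
      then have "mx a (F j) < mn a (F i)" using v ij k by (simp add: Fv)
      then show ?thesis using mn_le_mx[OF c(1,2), of a] by auto
    qed
  qed auto
  moreover have "convex hull (F i \<union> F ((i + 1) mod k)) \<inter> convex hull (F j \<union> F ((j + 1) mod k)) = {}"
    if "i < k" "j < k" "{i, (i + 1) mod k} \<inter> {j, (j + 1) mod k} = {}" for i j
  proof (cases i j rule: linorder_cases)
    case less
    then show ?thesis using hulls[of i j] that by simp
  next
    case equal
    then show ?thesis using that by simp
  next
    case greater
    then show ?thesis using hulls[of j i] that by (simp add: Int_commute)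
  qed
  ultimately show ?thesis unfolding is_C_def k_def[symmetric] F_def[symmetric] by blast
qed

text \<open>The partners may touch the line \<open>{x. a \<bullet> x = b}\<close>. When they do so from both sides, they do so in
  different halves of it, so the line itself can be split between \<open>Up\<close> and \<open>Down\<close>.\<close>
lemma lexicographic_separation:
  fixes a d :: "'a::real_inner"
  assumes left: "\<And>x. x \<in> u \<union> v \<Longrightarrow> d \<bullet> x \<le> c" and right: "\<And>x. x \<in> u' \<union> v' \<Longrightarrow> c < d \<bullet> x"
    and u: "\<And>x. x \<in> u \<union> u' \<Longrightarrow> b \<le> a \<bullet> x" and v: "\<And>x. x \<in> v \<union> v' \<Longrightarrow> a \<bullet> x \<le> b"
    and strict: "(\<forall>x\<in>u. b < a \<bullet> x) \<or> (\<forall>x\<in>v. a \<bullet> x < b)"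
    and strict': "(\<forall>x\<in>u'. b < a \<bullet> x) \<or> (\<forall>x\<in>v'. a \<bullet> x < b)"
  obtains Up Down where "convex Up" "convex Down" "Up \<inter> Down = {}" "u \<union> u' \<subseteq> Up" "v \<union> v' \<subseteq> Down"
    "{x. b < a \<bullet> x} \<subseteq> Up" "{x. a \<bullet> x < b} \<subseteq> Down"
proof -
  have "\<exists>T. convex T \<and> convex (- T) \<and> u \<union> u' \<subseteq> {x. b < a \<bullet> x} \<union> {x. a \<bullet> x = b} \<inter> T \<and>
    v \<union> v' \<subseteq> {x. a \<bullet> x < b} \<union> {x. a \<bullet> x = b} \<inter> - T"
  proof -
    have H: "- {x. d \<bullet> x \<le> c} = {x. c < d \<bullet> x}" "- {x. c < d \<bullet> x} = {x. d \<bullet> x \<le> c}" by auto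
    have C: "convex {x. d \<bullet> x \<le> c}" "convex {x. c < d \<bullet> x}"
      by (rule convex_halfspace_le convex_halfspace_gt)+
    have U: "a \<bullet> x = b \<or> b < a \<bullet> x" if "x \<in> u \<union> u'" for x using u[OF that] by linarith
    have V: "a \<bullet> x = b \<or> a \<bullet> x < b" if "x \<in> v \<union> v'" for x using v[OF that] by linarith
    \<comment> \<open>\<open>T\<close> is the part of the boundary line given to \<open>Up\<close>:
      nothing if no upper partner touches the line, everything if no lower partner does, and
      otherwise the half on the side of the upper partner that may touch.\<close>
    from strict strict' consider
      "\<forall>x\<in>u \<union> u'. b < a \<bullet> x" | "\<forall>x\<in>v \<union> v'. a \<bullet> x < b" |
      "\<forall>x\<in>u. b < a \<bullet> x" "\<forall>x\<in>v'. a \<bullet> x < b" | "\<forall>x\<in>v. a \<bullet> x < b" "\<forall>x\<in>u'. b < a \<bullet> x" by blast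
    then show ?thesis
    proof cases
      case 1 then show ?thesis using V by (intro exI[of _ "{}"]) auto
    next
      case 2 then show ?thesis using U by (intro exI[of _ UNIV]) auto
    next
      case 3 then show ?thesis using U V left right C
        by (intro exI[of _ "{x. c < d \<bullet> x}"]) (auto simp: H)
    next
      case 4 then show ?thesis using U V left right C
        by (intro exI[of _ "{x. d \<bullet> x \<le> c}"]) (auto simp: H)
    qed
  qed
  then obtain T where T: "convex T" "convex (- T)"
    "u \<union> u' \<subseteq> {x. b < a \<bullet> x} \<union> {x. a \<bullet> x = b} \<inter> T"
    "v \<union> v' \<subseteq> {x. a \<bullet> x < b} \<union> {x. a \<bullet> x = b} \<inter> - T" by blast
  show thesis
  proof (rule that)
    show "convex ({x. b < a \<bullet> x} \<union> {x. a \<bullet> x = b} \<inter> T)"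
      by (rule convex_lexicographic_halfspace[OF T(1)])
    show "convex ({x. a \<bullet> x < b} \<union> {x. a \<bullet> x = b} \<inter> - T)"
      using convex_lexicographic_halfspace[OF T(2), of "- b" "- a"] by simp
  qed (use T in auto)
qed

text \<open>Lines are coded as pairs of a normal and an offset, the form needed for the compactness
  argument. In the main case one line has the balanced slope and \<open>k - 3\<close> lines are
  vertical.\<close>

lemma finite_C_free_pierced:
  assumes "k \<ge> 4" and fin: "finite \<F>"
    and cc: "\<And>S. S \<in> \<F> \<Longrightarrow> compact S \<and> convex S \<and> S \<noteq> {}"
    and free: "C_free k \<F>"
  shows "\<exists>x. (\<forall>i<k - 2. fst (x i) \<noteq> 0) \<and> (\<forall>S\<in>\<F>. \<exists>i<k - 2. \<exists>p\<in>S. fst (x i) \<bullet> p = snd (x i))"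
proof (cases "\<exists>G\<in>\<F>. \<exists>H\<in>\<F>. mx e1 G < mn e1 H")
  case False
  \<comment> \<open>One-dimensional Helly: if no vertical line strictly separates two members, the
    vertical line at the smallest right end meets them all.\<close>
  have "\<exists>c. \<forall>S\<in>\<F>. mn e1 S \<le> c \<and> c \<le> mx e1 S"
  proof (cases "\<F> = {}")
    case ne: False
    obtain G0 where "G0 \<in> \<F>" "\<And>S. S \<in> \<F> \<Longrightarrow> mx e1 G0 \<le> mx e1 S"
      using arg_min_if_finite(1)[OF fin ne] arg_min_least[OF fin ne] by metis
    then show ?thesis using False by (intro exI[of _ "mx e1 G0"]) (meson not_less)
  qed simp
  then obtain c where c: "\<forall>S\<in>\<F>. mn e1 S \<le> c \<and> c \<le> mx e1 S" ..
  have meets: "\<exists>p\<in>S. e1 \<bullet> p = c" if "S \<in> \<F>" for S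
    using hyperplane_meets[of S e1 c] cc[OF that] c that by simp
  have "0 < k - 2" using assms(1) by simp
  then have "\<exists>i<k - 2. \<exists>p\<in>S. e1 \<bullet> p = c" if "S \<in> \<F>" for S using meets[OF that] by blast
  then show ?thesis by (intro exI[of _ "\<lambda>_. (e1, c)"]) (simp add: axis_eq_0_iff)
next
  case True
  have cpt: "compact S \<and> S \<noteq> {}" if "S \<in> \<F>" for S using cc that by blast
  from True obtain G H where "G \<in> \<F>" "H \<in> \<F>" "mx e1 G < mn e1 H" by blast
  from balanced_slope[OF fin cpt this] obtain m where m:
    "balance \<F> (mx e1) (mn (slope_normal m)) (mx (slope_normal m)) =
     balance \<F> (\<lambda>S. - mn e1 S) (mn (slope_normal m)) (mx (slope_normal m))" ..
  define a where "a = slope_normal m"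
  define b where "b = balance \<F> (mx e1) (mn a) (mx a)"
  have b: "balance \<F> (mx e1) (mn a) (mx a) = b" "balance \<F> (\<lambda>S. - mn e1 S) (mn a) (mx a) = b"
    using m by (simp_all add: a_def b_def)
  define U where "U = {S \<in> \<F>. b < mn a S \<or> mx a S < b}"
  have U: "finite U" "U \<subseteq> \<F>" using fin by (auto simp: U_def)
  have "mn e1 S \<le> mx e1 S" if "S \<in> U" for S
  proof -
    have "S \<in> \<F>" using that U(2) by blast
    then show ?thesis using mn_le_mx[of S e1] cpt[of S] by simp
  qed
  from interval_piercing_or_chain[of U "mn e1" "mx e1" "k - 3", OF U(1) this] consider
    (pierced) c where "\<forall>G\<in>U. \<exists>i<k - 3. mn e1 G \<le> c i \<and> c i \<le> mx e1 G" |
    (chain) Gs where "length Gs = Suc (k - 3)" "set Gs \<subseteq> U" "sorted_wrt (\<lambda>G H. mx e1 G < mn e1 H) Gs"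
    by metis
  then show ?thesis
  proof cases
    case pierced
    \<comment> \<open>The last index, \<open>k - 3\<close>, carries the sloped line, which meets
      every member outside \<open>U\<close>.\<close>
    define x where "x = (\<lambda>i. if i < k - 3 then (e1, c i) else (a, b))"
    have "\<exists>i<k - 2. \<exists>p\<in>S. fst (x i) \<bullet> p = snd (x i)" if S: "S \<in> \<F>" for S
    proof (cases "S \<in> U")
      case True
      then obtain i where "i < k - 3" "mn e1 S \<le> c i" "c i \<le> mx e1 S" using pierced by blast
      then show ?thesis using hyperplane_meets[of S e1 "c i"] cc[OF S]
        by (intro exI[of _ i]) (simp add: x_def)
    next
      case False
      then have "mn a S \<le> b" "b \<le> mx a S" using S by (auto simp: U_def)
      then have "\<exists>p\<in>S. a \<bullet> p = b" using hyperplane_meets[of S a b] cc[OF S] by simp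
      moreover have "k - 3 < k - 2" using assms(1) by simp
      ultimately show ?thesis by (intro exI[of _ "k - 3"]) (simp add: x_def)
    qed
    moreover have "fst (x i) \<noteq> 0" for i
      by (simp add: x_def a_def slope_normal_nonzero axis_eq_0_iff)
    ultimately show ?thesis by blast
  next
    case chain
    \<comment> \<open>The chain has \<open>k - 2\<close> members. Keeping its \<open>k - 4\<close>
      inner ones and replacing each end by a pair of partners gives \<open>k\<close> sets.\<close>
    then obtain A Ms B where Gs: "Gs = A # Ms @ [B]"
      using assms(1) by (cases Gs; cases "tl Gs" rule: rev_cases) auto
    have Ms: "length Ms + 4 = k" "set Ms \<subseteq> U" "sorted_wrt (\<lambda>G H. mx e1 G < mn e1 H) Ms"
      "\<And>M. M \<in> set Ms \<Longrightarrow> mx e1 A < mn e1 M \<and> mx e1 M < mn e1 B" "mx e1 A < mn e1 B"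
      using chain assms(1) by (auto simp: Gs sorted_wrt_append)
    have AB: "A \<in> U" "B \<in> U" using chain(2) Gs by auto
    have sides: "b < mn a A \<or> mx a A < b" "b < mn a B \<or> mx a B < b" using AB by (auto simp: U_def)
    obtain u v u' v' where F: "u \<in> \<F>" "v \<in> \<F>" "u' \<in> \<F>" "v' \<in> \<F>"
      and uv: "mx e1 u \<le> mx e1 A" "mx e1 v \<le> mx e1 A" "b \<le> mn a u" "mx a v \<le> b" "b < mn a u \<or> mx a v < b"
      and uv': "mn e1 B \<le> mn e1 u'" "mn e1 B \<le> mn e1 v'" "b \<le> mn a u'" "mx a v' \<le> b" "b < mn a u' \<or> mx a v' < b"
    proof -
      have AB': "A \<in> \<F>" "B \<in> \<F>" using AB U(2) by auto
      obtain u v where "u \<in> \<F>" "v \<in> \<F>" "mx e1 u \<le> mx e1 A" "mx e1 v \<le> mx e1 A"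
        "b \<le> mn a u" "mx a v \<le> b" "b < mn a u \<or> mx a v < b"
        using balance_partners[OF fin AB'(1) b(1) sides(1)] by blast
      moreover obtain u' v' where "u' \<in> \<F>" "v' \<in> \<F>" "- mn e1 u' \<le> - mn e1 B" "- mn e1 v' \<le> - mn e1 B"
        "b \<le> mn a u'" "mx a v' \<le> b" "b < mn a u' \<or> mx a v' < b"
        using balance_partners[OF fin AB'(2) b(2) sides(2)] by blast
      ultimately show thesis using that[of u v u' v'] by simp
    qed
    have ge: "c \<le> d \<bullet> x" if "c \<le> mn d S" "x \<in> S" "S \<in> \<F>" for c d x S
      using that mn_le cpt by (meson order_trans)
    have le: "d \<bullet> x \<le> c" if "mx d S \<le> c" "x \<in> S" "S \<in> \<F>" for c d x S
      using that le_mx cpt by (meson order_trans)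
    have gt: "c < d \<bullet> x" if "c < mn d S" "x \<in> S" "S \<in> \<F>" for c d x S
      using that mn_le cpt by (meson less_le_trans)
    have lt: "d \<bullet> x < c" if "mx d S < c" "x \<in> S" "S \<in> \<F>" for c d x S
      using that le_mx cpt by (meson le_less_trans)
    \<comment> \<open>The vertical line at the right end of \<open>A\<close> has the left partners
      weakly on its left and the right partners strictly on its right, since \<open>A\<close> ends
      before \<open>B\<close> begins.\<close>
    obtain Up Down where UD: "convex Up" "convex Down" "Up \<inter> Down = {}" "u \<union> u' \<subseteq> Up" "v \<union> v' \<subseteq> Down"
      "{x. b < a \<bullet> x} \<subseteq> Up" "{x. a \<bullet> x < b} \<subseteq> Down"
    proof (rule lexicographic_separation[of u v e1 "mx e1 A" u' v' b a])
      show "\<And>x. x \<in> u \<union> v \<Longrightarrow> e1 \<bullet> x \<le> mx e1 A" using uv F le by blast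
      show "mx e1 A < e1 \<bullet> x" if "x \<in> u' \<union> v'" for x
      proof -
        have "mn e1 B \<le> e1 \<bullet> x" using ge[of "mn e1 B" e1 _ x] uv' F that by blast
        then show ?thesis using Ms(5) by linarith
      qed
      show "\<And>x. x \<in> u \<union> u' \<Longrightarrow> b \<le> a \<bullet> x" using uv uv' F ge by blast
      show "\<And>x. x \<in> v \<union> v' \<Longrightarrow> a \<bullet> x \<le> b" using uv uv' F le by blast
      show "(\<forall>x\<in>u. b < a \<bullet> x) \<or> (\<forall>x\<in>v. a \<bullet> x < b)" using uv(5) F gt lt by blast
      show "(\<forall>x\<in>u'. b < a \<bullet> x) \<or> (\<forall>x\<in>v'. a \<bullet> x < b)" using uv'(5) F gt lt by blast
    qed blast
    define Mu where "Mu = filter (\<lambda>S. b < mn a S) Ms"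
    \<comment> \<open>Members of \<open>U\<close> miss the line, so those not strictly above it are
      strictly below it.\<close>
    define Mv where "Mv = filter (\<lambda>S. \<not> b < mn a S) Ms"
    define us where "us = u # Mu @ [u']"
    define vs where "vs = v # Mv @ [v']"
    have sub: "set Mu \<subseteq> set Ms" "set Mv \<subseteq> set Ms" by (auto simp: Mu_def Mv_def)
    have len: "length us = Suc (Suc (length Mu))" "length vs = Suc (Suc (length Mv))"
      "length us + length vs = k"
      using Ms(1) sum_length_filter_compl[of "\<lambda>S. b < mn a S" Ms]
      by (auto simp: us_def vs_def Mu_def Mv_def)
    have sorted: "sorted_wrt (\<lambda>G H. mx e1 G < mn e1 H) Mu" "sorted_wrt (\<lambda>G H. mx e1 G < mn e1 H) Mv"
      using Ms(3) by (auto simp: Mu_def Mv_def sorted_wrt_filter)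
    \<comment> \<open>\<open>u\<close> and \<open>v\<close> end no later than \<open>A\<close>, and
      \<open>u'\<close> and \<open>v'\<close> begin no earlier than \<open>B\<close>, so the
      partners inherit the separations of the chain ends.\<close>
    have left: "mx e1 S < mn e1 M" if "S \<in> {u, v}" "M \<in> set Ms \<union> {u', v'}" for S M
      using that Ms(4)[of M] Ms(5) uv uv' by auto
    have right: "mx e1 M < mn e1 S" if "S \<in> {u', v'}" "M \<in> set Ms \<union> {u, v}" for S M
      using that Ms(4)[of M] Ms(5) uv uv' by auto
    have members: "S \<in> \<F>" if "S \<in> set us \<union> set vs" for S
      using that F sub Ms(2) U(2) by (auto simp: us_def vs_def)
    have mid: "vs ! Suc i \<in> set Ms \<union> {u', v'}" if "i \<le> length Mv" for i
    proof -
      have "vs ! Suc i = (Mv @ [v']) ! i" by (simp add: vs_def)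
      also have "\<dots> \<in> set (Mv @ [v'])" by (rule nth_mem) (use that in simp)
      also have "\<dots> \<subseteq> set Ms \<union> {u', v'}" using sub by auto
      finally show ?thesis .
    qed
    have mid': "us ! Suc i \<in> set Ms \<union> {u', v'}" if "i \<le> length Mu" for i
    proof -
      have "us ! Suc i = (Mu @ [u']) ! i" by (simp add: us_def)
      also have "\<dots> \<in> set (Mu @ [u'])" by (rule nth_mem) (use that in simp)
      also have "\<dots> \<subseteq> set Ms \<union> {u', v'}" using sub by auto
      finally show ?thesis .
    qed
    have mid2: "vs ! i \<in> set Ms \<union> {u, v}" if "i \<le> length Mv" for i
    proof -
      have "vs ! i = (v # Mv) ! i" using that by (cases i) (simp_all add: vs_def nth_append)
      also have "\<dots> \<in> set (v # Mv)" by (rule nth_mem) (use that in simp)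
      also have "\<dots> \<subseteq> set Ms \<union> {u, v}" using sub by auto
      finally show ?thesis .
    qed
    have mid2': "us ! i \<in> set Ms \<union> {u, v}" if "i \<le> length Mu" for i
    proof -
      have "us ! i = (u # Mu) ! i" using that by (cases i) (simp_all add: us_def nth_append)
      also have "\<dots> \<in> set (u # Mu)" by (rule nth_mem) (use that in simp)
      also have "\<dots> \<subseteq> set Ms \<union> {u, v}" using sub by auto
      finally show ?thesis .
    qed
    have ends: "us ! 0 = u" "vs ! 0 = v" "us ! Suc (length Mu) = u'" "vs ! Suc (length Mv) = v'"
      by (auto simp: us_def vs_def)
    have "is_C (length us + length vs) ((!) (us @ rev vs))"
    proof (rule two_chains_is_C[where a = e1, OF _ UD(1) _ UD(2) _ UD(3) _ len(1) _ len(2)])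
      show "compact S \<and> S \<noteq> {}" if "S \<in> set us \<union> set vs" for S using members that cpt by blast
      show "S \<subseteq> Up" if "S \<in> set us" for S
      proof -
        have "S \<subseteq> {x. b < a \<bullet> x}" if "S \<in> set Mu"
          using gt[of b a S] that sub Ms(2) U(2) by (auto simp: Mu_def)
        then show ?thesis using that UD(4,6) by (auto simp: us_def)
      qed
      show "S \<subseteq> Down" if "S \<in> set vs" for S
      proof -
        have "S \<subseteq> {x. a \<bullet> x < b}" if "S \<in> set Mv"
          using lt[of a S b] that sub Ms(2) U(2) by (auto simp: Mv_def U_def)
        then show ?thesis using that UD(5,7) by (auto simp: vs_def)
      qed
      have "\<forall>M\<in>set Mu. mx e1 u < mn e1 M" by (intro ballI left) (use sub in blast)+
      moreover have "\<forall>M\<in>set Mu. mx e1 M < mn e1 u'" by (intro ballI right) (use sub in blast)+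
      moreover have "mx e1 u < mn e1 u'" by (intro left) simp_all
      ultimately show "sorted_wrt (\<lambda>A B. mx e1 A < mn e1 B) us"
        using sorted by (simp add: us_def sorted_wrt_append)
      have "\<forall>M\<in>set Mv. mx e1 v < mn e1 M" by (intro ballI left) (use sub in blast)+
      moreover have "\<forall>M\<in>set Mv. mx e1 M < mn e1 v'" by (intro ballI right) (use sub in blast)+
      moreover have "mx e1 v < mn e1 v'" by (intro left) simp_all
      ultimately show "sorted_wrt (\<lambda>A B. mx e1 A < mn e1 B) vs"
        using sorted by (simp add: vs_def sorted_wrt_append)
      show "mx e1 (us ! 0) < mn e1 (vs ! Suc i)" if "i \<le> length Mv" for i
        unfolding ends by (rule left[OF _ mid[OF that]]) simp
      show "mx e1 (vs ! 0) < mn e1 (us ! Suc i)" if "i \<le> length Mu" for i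
        unfolding ends by (rule left[OF _ mid'[OF that]]) simp
      show "mx e1 (vs ! i) < mn e1 (us ! Suc (length Mu))" if "i \<le> length Mv" for i
        unfolding ends by (rule right[OF _ mid2[OF that]]) simp
      show "mx e1 (us ! i) < mn e1 (vs ! Suc (length Mv))" if "i \<le> length Mu" for i
        unfolding ends by (rule right[OF _ mid2'[OF that]]) simp
    qed
    then have "is_C k ((!) (us @ rev vs))" by (simp add: len(3))
    moreover have "(!) (us @ rev vs) ` {..<k} \<subseteq> \<F>"
    proof -
      have "(!) (us @ rev vs) ` {..<k} = set (us @ rev vs)"
        unfolding set_conv_nth using len(3) by auto
      then show ?thesis using members by auto
    qed
    ultimately show ?thesis using free unfolding C_free_def by blast
  qed
qed

section \<open>Passage to infinite families by homogeneous line coordinates\<close>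

lemma is_line_hyperplane: "a \<noteq> 0 \<Longrightarrow> is_line {x. a \<bullet> x = c}"
  by (simp add: is_line_def affine_hyperplane aff_dim_hyperplane)

text \<open>Incidence is a closed relation, and projecting it along the compact factor
  \<open>S\<close> preserves closedness.\<close>

lemma closed_hyperplanes_meeting:
  fixes S :: "'a::euclidean_space set"
  assumes "compact S"
  shows "closed {w::'a \<times> real. \<exists>p\<in>S. fst w \<bullet> p = snd w}"
proof -
  have "closed {z::'a \<times> ('a \<times> real). fst (snd z) \<bullet> fst z = snd (snd z)}"
    by (intro closed_Collect_eq continuous_intros)
  then have "closedin (top_of_set (S \<times> UNIV)) (S \<times> UNIV \<inter> {z::'a \<times> ('a \<times> real). fst (snd z) \<bullet> fst z = snd (snd z)})"
    by (rule closedin_closed_Int)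
  from closedin_compact_projection[OF assms this] show ?thesis
    by (auto simp: Bex_def elim!: back_subst[of closed])
qed

text \<open>Incidence is invariant under scaling of the pair, so normalised pairs on the unit sphere
  form a compact parameter space for the lines.\<close>

lemma lines_suffice_upper:
  assumes "k \<ge> 4"
  shows "lines_suffice k (k - 2)"
  unfolding lines_suffice_def
proof (intro allI impI)
  fix \<F> :: "plane set set"
  assume cc: "\<forall>S\<in>\<F>. compact S \<and> convex S \<and> S \<noteq> {}" and free: "C_free k \<F>"
  define R where "R = (\<lambda>S. {w::plane \<times> real. \<exists>p\<in>S. fst w \<bullet> p = snd w})"
  have "\<exists>x. (\<forall>i<k - 2. x i \<in> sphere 0 1) \<and> (\<forall>S\<in>\<F>. \<exists>i<k - 2. x i \<in> R S)"
  proof (rule piercing_compactness)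
    show "compact (sphere (0::plane \<times> real) 1)" by simp
    show "closed (R S)" if "S \<in> \<F>" for S
      unfolding R_def using that cc by (intro closed_hyperplanes_meeting) blast
    fix \<G> assume G: "finite \<G>" "\<G> \<subseteq> \<F>"
    have "C_free k \<G>" using free G(2) unfolding C_free_def by blast
    then obtain x :: "nat \<Rightarrow> plane \<times> real" where x: "\<And>i. i < k - 2 \<Longrightarrow> fst (x i) \<noteq> 0"
      "\<forall>S\<in>\<G>. \<exists>i<k - 2. \<exists>p\<in>S. fst (x i) \<bullet> p = snd (x i)"
      using finite_C_free_pierced[OF assms G(1)] cc G(2) by (metis subsetD)
    let ?y = "\<lambda>i. x i /\<^sub>R norm (x i)"
    have "x i \<noteq> 0" if "i < k - 2" for i using x(1)[OF that] by auto
    then have "?y i \<in> sphere 0 1" if "i < k - 2" for i using that by simp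
    moreover have "?y i \<in> R S" if "x i \<in> R S" for i S
      using that by (auto simp: R_def)
    ultimately show "\<exists>x. (\<forall>i<k - 2. x i \<in> sphere 0 1) \<and> (\<forall>S\<in>\<G>. \<exists>i<k - 2. x i \<in> R S)"
      using x(2) by (intro exI[of _ ?y]) (fastforce simp: R_def)
  qed
  then obtain x where x: "\<forall>i<k - 2. x i \<in> sphere 0 1" "\<forall>S\<in>\<F>. \<exists>i<k - 2. x i \<in> R S" by blast
  \<comment> \<open>A unit pair with zero normal represents the line at infinity. It meets no
    member, so an arbitrary line may take its place.\<close>
  define l where "l = (\<lambda>i. if fst (x i) = 0 then {p. e1 \<bullet> p = 0} else {p. fst (x i) \<bullet> p = snd (x i)})"
  have "is_line (l i)" for i
    by (auto simp: l_def is_line_hyperplane axis_eq_0_iff)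
  moreover have "S \<inter> (\<Union>i<k - 2. l i) \<noteq> {}" if S: "S \<in> \<F>" for S
  proof -
    obtain i p where i: "i < k - 2" "p \<in> S" "fst (x i) \<bullet> p = snd (x i)"
      using x(2) S by (auto simp: R_def)
    have "fst (x i) \<noteq> 0"
    proof
      assume "fst (x i) = 0"
      then have "x i = 0" using i(3) by (simp add: prod_eq_iff)
      then show False using x(1) i(1) by force
    qed
    then show ?thesis using i by (auto simp: l_def)
  qed
  ultimately show "\<exists>l. (\<forall>i<k - 2. is_line (l i)) \<and> pierced_by \<F> l (k - 2)"
    unfolding pierced_by_def by blast
qed

subsection \<open>Sides of a convex polygon\<close>

text \<open>The identity \<open>id\<close> compares the value at \<open>i\<close> with the chord
  over \<open>p\<close> and \<open>q\<close>; for positive \<open>a\<close> the defect is strict.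
  For \<open>a = 0\<close> the function is strictly monotone.\<close>

lemma quadratic_neg_between:
  fixes a b c :: real
  assumes "a \<ge> 0" "a \<noteq> 0 \<or> b \<noteq> 0" "p < i" "i < q"
    and "a * p\<^sup>2 + b * p + c \<le> 0" "a * q\<^sup>2 + b * q + c \<le> 0"
  shows "a * i\<^sup>2 + b * i + c < 0"
proof -
  let ?g = "\<lambda>t. a * t\<^sup>2 + b * t + c"
  have id: "?g i * (q - p) = ?g p * (q - i) + ?g q * (i - p) - a * ((q - p) * ((i - p) * (q - i)))"
    by (simp add: power2_eq_square algebra_simps)
  have le: "?g p * (q - i) \<le> 0" "?g q * (i - p) \<le> 0"
    using assms by (auto intro: mult_nonpos_nonneg)
  show ?thesis
  proof (cases "a = 0")
    case True
    then have b: "b \<noteq> 0" using assms(2) by simp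
    have "b * p + c \<le> 0" "b * q + c \<le> 0" using assms True by auto
    moreover have "b * p < b * i \<and> b * i < b * q \<or> b * p > b * i \<and> b * i > b * q"
      using b assms by (cases "b > 0") auto
    ultimately show ?thesis using True by auto
  next
    case False
    then have "a * ((q - p) * ((i - p) * (q - i))) > 0" using assms by (intro mult_pos_pos) auto
    then have "?g i * (q - p) < 0" using id le by linarith
    then show ?thesis using assms by (simp add: mult_less_0_iff)
  qed
qed

text \<open>The sides of a convex polygon inscribed in the parabola; index \<open>N - 1\<close> is the closing side.\<close>
definition vertex :: "nat \<Rightarrow> plane" where
  "vertex i = vector [real i, (real i)\<^sup>2]"

definition side :: "nat \<Rightarrow> nat \<Rightarrow> plane set" where
  "side N i = closed_segment (vertex i) (vertex (Suc i mod N))"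

text \<open>Otherwise an open halfspace contains both end points and hence the segment. This turns
  incidence into a sign condition at the vertices.\<close>

lemma closed_segment_meets_hyperplane:
  assumes "x \<in> closed_segment u v" "a \<bullet> x = c"
  shows "(a \<bullet> u - c) * (a \<bullet> v - c) \<le> 0"
proof (rule ccontr)
  assume "\<not> ?thesis"
  then consider "a \<bullet> u > c" "a \<bullet> v > c" | "a \<bullet> u < c" "a \<bullet> v < c"
    by (auto simp: not_le zero_less_mult_iff)
  then show False
  proof cases
    case 1
    then have "closed_segment u v \<subseteq> {x. a \<bullet> x > c}"
      by (intro closed_segment_subset convex_halfspace_gt) auto
    with assms show False by auto
  next
    case 2
    then have "closed_segment u v \<subseteq> {x. a \<bullet> x < c}"
      by (intro closed_segment_subset convex_halfspace_lt) auto
    with assms show False by auto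
  qed
qed

text \<open>The indices with \<open>g i \<le> 0\<close> run from some \<open>p\<close> to some
  \<open>q\<close>, with negative values strictly between. Besides the closing index, only the
  indices next to these two ends can count. Four rather than two are possible because a line through
  a vertex meets both sides there.\<close>

lemma cyclic_sign_changes_le_4:
  fixes a b c :: real
  assumes "a \<ge> 0" "a \<noteq> 0 \<or> b \<noteq> 0" "N \<ge> 1"
  defines "g \<equiv> \<lambda>i::nat. a * (real i)\<^sup>2 + b * real i + c"
  shows "card {i\<in>{..<N}. g i * g (Suc i mod N) \<le> 0} \<le> 4"
proof -
  let ?H = "{i\<in>{..<N}. g i * g (Suc i mod N) \<le> 0}"
  let ?J = "{i\<in>{..<N}. g i \<le> 0}"
  show ?thesis
  proof (cases "?J = {}")
    case True
    then have pos: "g i > 0" if "i < N" for i using that by force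
    have "g i * g (Suc i mod N) > 0" if "i < N" for i
      using that assms(3) by (intro mult_pos_pos pos) auto
    then have "?H = {}" by (force simp: not_le)
    then show ?thesis by (simp only: card.empty)
  next
    case False
    define p q where "p = Min ?J" and "q = Max ?J"
    have fin: "finite ?J" by simp
    have pJ: "p < N" "g p \<le> 0" and qJ: "q < N" "g q \<le> 0"
      using Min_in[OF fin False] Max_in[OF fin False] by (auto simp: p_def q_def)
    have outside: "g i > 0" if "i < N" "i < p \<or> q < i" for i
    proof (rule ccontr)
      assume "\<not> g i > 0"
      then have "i \<in> ?J" using that by auto
      then have "p \<le> i" "i \<le> q" using Min_le[OF fin] Max_ge[OF fin] by (auto simp: p_def q_def)
      then show False using that by auto
    qed
    have inside: "g i < 0" if "p < i" "i < q" for i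
      using quadratic_neg_between[of a b "real p" "real i" "real q" c] assms that pJ qJ
      by (auto simp: g_def)
    have sides: "i = N - 1 \<or> i = p \<or> i = q \<or> Suc i = p \<or> Suc i = q" if i: "i \<in> ?H" for i
    proof (rule ccontr)
      assume neg: "\<not> ?thesis"
      then have S: "Suc i mod N = Suc i" "Suc i < N" using i by auto
      have *: "g i * g (Suc i) \<le> 0" "i < N" using i S by auto
      consider "i < p" "Suc i < p" | "i > q" "Suc i > q" | "p < i" "Suc i < q" using neg by linarith
      then have "g i * g (Suc i) > 0"
      proof cases
        case 1
        then show ?thesis using outside[of i] outside[of "Suc i"] S * by simp
      next
        case 2
        then show ?thesis using outside[of i] outside[of "Suc i"] S * by simp
      next
        case 3
        then show ?thesis using inside[of i] inside[of "Suc i"] by (simp add: mult_neg_neg)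
      qed
      then show False using * by simp
    qed
    have closing: "p = 0 \<or> q = N - 1" if "N - 1 \<in> ?H"
    proof (rule ccontr)
      assume "\<not> ?thesis"
      then have "0 < p" "q < N - 1" using qJ by linarith+
      then have "g 0 > 0" "g (N - 1) > 0"
        using outside[of 0] outside[of "N - 1"] pJ(1) by simp_all
      then have "g (N - 1) * g 0 > 0" by simp
      moreover have "g (N - 1) * g (Suc (N - 1) mod N) \<le> 0" "Suc (N - 1) = N"
        using that assms(3) by simp_all
      ultimately show False by simp
    qed
    \<comment> \<open>A closing index that counts is no fifth one: for \<open>p = 0\<close> it
      replaces the missing predecessor of \<open>p\<close>, and for \<open>q = N - 1\<close> it is
      \<open>q\<close> itself.\<close>
    have "?H \<subseteq> {p, q, p - 1, q - 1} \<or> ?H \<subseteq> {N - 1, p, q, q - 1}"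
    proof (cases "N - 1 \<in> ?H")
      case False
      have "?H \<subseteq> {p, q, p - 1, q - 1}"
      proof
        fix i assume "i \<in> ?H"
        then show "i \<in> {p, q, p - 1, q - 1}" using sides[of i] False by auto
      qed
      then show ?thesis by blast
    next
      case True
      from closing[OF True] show ?thesis
      proof
        assume "p = 0"
        have "?H \<subseteq> {N - 1, p, q, q - 1}"
        proof
          fix i assume "i \<in> ?H"
          then show "i \<in> {N - 1, p, q, q - 1}" using sides[of i] \<open>p = 0\<close> by auto
        qed
        then show ?thesis by blast
      next
        assume "q = N - 1"
        have "?H \<subseteq> {p, q, p - 1, q - 1}"
        proof
          fix i assume "i \<in> ?H"
          then show "i \<in> {p, q, p - 1, q - 1}" using sides[of i] \<open>q = N - 1\<close> by auto
        qed
        then show ?thesis by blast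
      qed
    qed
    moreover have "card {p, q, p - 1, q - 1} \<le> 4" "card {N - 1, p, q, q - 1} \<le> 4"
      by (auto intro!: order_trans[OF card_insert_le_m1] simp: card_insert_if)
    ultimately show ?thesis by (meson card_mono finite.emptyI finite.insertI order_trans)
  qed
qed

lemma is_line_imp_hyperplane:
  assumes "is_line l"
  obtains a c where "a \<noteq> 0" "l = {x. a \<bullet> x = c}"
proof -
  have "aff_dim l = int (DIM(plane)) - 1" using assms by (simp add: is_line_def)
  then have "\<exists>a c. a \<noteq> 0 \<and> affine hull l = {x. a \<bullet> x = c}"
    using aff_dim_eq_hyperplane[of l] by simp
  then show thesis using that assms by (metis is_line_def hull_same affine_hull_eq)
qed

text \<open>On the parabola the equation of a line becomes a quadratic in the vertex index, so the
  sign count applies.\<close>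

lemma card_sides_meeting_line_le_4:
  assumes "is_line l" "N \<ge> 1"
  shows "card {i\<in>{..<N}. side N i \<inter> l \<noteq> {}} \<le> 4"
proof -
  obtain a c where ac: "a \<noteq> 0" "l = {x. a \<bullet> x = c}" using is_line_imp_hyperplane[OF assms(1)] .
  \<comment> \<open>The sign makes the leading coefficient nonnegative; it cancels in products of
    two values.\<close>
  define \<sigma> :: real where "\<sigma> = (if a $ 2 \<ge> 0 then 1 else - 1)"
  define g where "g = (\<lambda>i::nat. (\<sigma> * a $ 2) * (real i)\<^sup>2 + (\<sigma> * a $ 1) * real i + - (\<sigma> * c))"
  have g: "g i = \<sigma> * (a \<bullet> vertex i - c)" for i
    by (simp add: g_def vertex_def inner_vec_def sum_2 algebra_simps)
  have \<sigma>: "\<sigma> * a $ 2 \<ge> 0" "\<sigma> * \<sigma> = 1" "\<sigma> \<noteq> 0" by (auto simp: \<sigma>_def)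
  have nz: "\<sigma> * a $ 2 \<noteq> 0 \<or> \<sigma> * a $ 1 \<noteq> 0" using ac(1) \<sigma>(3) by (auto simp: vec_eq_iff forall_2)
  have "g i * g (Suc i mod N) \<le> 0" if meets: "side N i \<inter> l \<noteq> {}" for i
  proof -
    obtain x where "x \<in> side N i" "a \<bullet> x = c" using meets ac(2) by blast
    then have "(a \<bullet> vertex i - c) * (a \<bullet> vertex (Suc i mod N) - c) \<le> 0"
      unfolding side_def by (rule closed_segment_meets_hyperplane)
    moreover have "g i * g (Suc i mod N) =
        (\<sigma> * \<sigma>) * ((a \<bullet> vertex i - c) * (a \<bullet> vertex (Suc i mod N) - c))"
      by (simp only: g mult_ac)
    ultimately show ?thesis by (simp add: \<sigma>)
  qed
  then have "card {i\<in>{..<N}. side N i \<inter> l \<noteq> {}} \<le> card {i\<in>{..<N}. g i * g (Suc i mod N) \<le> 0}"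
    by (intro card_mono) auto
  also have "\<dots> \<le> 4" unfolding g_def by (rule cyclic_sign_changes_le_4[OF \<sigma>(1) nz assms(2)])
  finally show ?thesis .
qed

section \<open>The lower bound from the sides of a polygon\<close>

lemma is_C_disjoint:
  assumes C: "is_C k F" and k: "k \<ge> 4" and ab: "a < k" "b < k" "a \<noteq> b"
  shows "F a \<inter> F b = {}"
proof -
  have key: "F x \<inter> F y = {}" if ij: "i < k" "j < k" and i': "(i + 1) mod k = i'" and j': "(j + 1) mod k = j'"
    and d: "i \<noteq> j" "i \<noteq> j'" "i' \<noteq> j" "i' \<noteq> j'" and xy: "x = i \<or> x = i'" "y = j \<or> y = j'"
    for i i' j j' x y
  proof -
    have "{i, (i + 1) mod k} \<inter> {j, (j + 1) mod k} = {}" unfolding i' j' using d by simp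
    then have "convex hull (F i \<union> F ((i + 1) mod k)) \<inter> convex hull (F j \<union> F ((j + 1) mod k)) = {}"
      using C ij by (simp only: is_C_def)
    moreover have "F x \<subseteq> convex hull (F i \<union> F ((i + 1) mod k))"
      by (rule order_trans[OF _ hull_subset]) (use xy i' in auto)
    moreover have "F y \<subseteq> convex hull (F j \<union> F ((j + 1) mod k))"
      by (rule order_trans[OF _ hull_subset]) (use xy j' in auto)
    ultimately show ?thesis by blast
  qed
  have *: "F a \<inter> F b = {}" if ab: "a < b" "b < k" for a b
  proof -
    define b' where "b' = (if b = k - 1 then 0 else b + 1)"
    have Sa: "(a + 1) mod k = a + 1" using ab by simp
    have Sb: "(b + 1) mod k = b'" using ab by (auto simp: b'_def)
    have b': "b' = 0 \<and> b = k - 1 \<or> b' = b + 1" by (auto simp: b'_def)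
    \<comment> \<open>Two disjoint cyclic edges through \<open>a\<close> and \<open>b\<close> are
      needed. For cyclic neighbours the first is joined to its predecessor and the second to its
      successor, which avoids overlap as \<open>k \<ge> 4\<close>; otherwise both are joined to
      their successors.\<close>
    consider "b = a + 1" "a > 0" | "b = a + 1" "a = 0" | "b = k - 1" "a = 0" | "b \<noteq> a + 1" "\<not> (b = k - 1 \<and> a = 0)"
      by linarith
    then show ?thesis
    proof cases
      case 1
      have "(a - 1 + 1) mod k = a" using 1 ab by simp
      from key[OF _ _ this Sb, of a b] show ?thesis using 1 ab k b' by linarith
    next
      case 2
      have "(k - 1 + 1) mod k = 0" using k by simp
      from key[OF _ _ this Sb, of a b] show ?thesis using 2 ab k b' by linarith
    next
      case 3
      have "(b - 1 + 1) mod k = b" using 3 ab by simp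
      from key[OF _ _ Sa this, of a b] show ?thesis using 3 ab k by linarith
    next
      case 4
      from key[OF _ _ Sa Sb, of a b] show ?thesis using 4 ab k b' by linarith
    qed
  qed
  show ?thesis using *[of a b] *[of b a] ab by (cases a b rule: linorder_cases) auto
qed

text \<open>Pigeonhole: \<open>k\<close> indices and their \<open>k\<close> cyclic successors cannot
  all be distinct among \<open>2 * k - 1\<close>, so two of the chosen sides are adjacent and share
  a vertex, against disjointness.\<close>

lemma C_free_sides:
  assumes "k \<ge> 4"
  shows "C_free k (side (2 * k - 1) ` {..<2 * k - 1})"
  unfolding C_free_def
proof
  define N where "N = 2 * k - 1"
  have N: "N \<ge> 2" "N < 2 * k" using assms by (auto simp: N_def)
  assume "\<exists>F. F ` {..<k} \<subseteq> side (2 * k - 1) ` {..<2 * k - 1} \<and> is_C k F"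
  then obtain F where F: "F ` {..<k} \<subseteq> side N ` {..<N}" "is_C k F" unfolding N_def by blast
  have "\<forall>i\<in>{..<k}. \<exists>t. t < N \<and> F i = side N t" using F(1) by blast
  then obtain t where t: "\<And>i. i < k \<Longrightarrow> t i < N \<and> F i = side N (t i)" by (metis lessThan_iff)
  have inj: "inj_on t {..<k}"
  proof (rule inj_onI)
    fix i j assume "i \<in> {..<k}" "j \<in> {..<k}" "t i = t j"
    moreover have "inj_on F {..<k}" using F(2) by (simp add: is_C_def)
    ultimately show "i = j" using t by (metis inj_onD lessThan_iff)
  qed
  define I where "I = t ` {..<k}"
  define s where "s = (\<lambda>i. Suc i mod N)"
  have I: "card I = k" "I \<subseteq> {..<N}" using inj t by (auto simp: I_def card_image)
  have "inj_on s {..<N}"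
    by (rule inj_onI) (auto simp: s_def mod_Suc split: if_splits)
  then have "card (s ` I) = k" using I by (simp add: card_image inj_on_subset)
  have "I \<inter> s ` I \<noteq> {}"
  proof
    assume "I \<inter> s ` I = {}"
    then have "card (I \<union> s ` I) = 2 * k"
      using I \<open>card (s ` I) = k\<close> by (subst card_Un_disjoint) (auto simp: I_def)
    moreover have "I \<union> s ` I \<subseteq> {..<N}" using I(2) N by (auto simp: s_def)
    then have "card (I \<union> s ` I) \<le> N" using card_mono[of "{..<N}"] by fastforce
    ultimately show False using N by simp
  qed
  then obtain i j where ij: "i < k" "j < k" "t j = s (t i)" by (auto simp: I_def)
  have "t i < N" using t ij by blast
  then have "t i \<noteq> s (t i)" using N by (auto simp: s_def mod_Suc)
  then have "i \<noteq> j" using ij by auto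
  then have "F i \<inter> F j = {}" using is_C_disjoint[OF F(2) assms] ij by blast
  moreover have "vertex (s (t i)) \<in> F i \<inter> F j"
    using t[OF ij(1)] t[OF ij(2)] ij(3) by (simp add: side_def s_def)
  ultimately show False by blast
qed

lemma lines_suffice_lower:
  assumes "k \<ge> 4" "lines_suffice k n"
  shows "2 * k - 1 \<le> 4 * n"
proof -
  define N where "N = 2 * k - 1"
  have "\<forall>S\<in>side N ` {..<N}. compact S \<and> convex S \<and> S \<noteq> {}"
    by (auto simp: side_def)
  moreover have "C_free k (side N ` {..<N})" using C_free_sides[OF assms(1)] by (simp add: N_def)
  ultimately obtain l where l: "\<forall>i<n. is_line (l i)" "pierced_by (side N ` {..<N}) l n"
    using assms(2) unfolding lines_suffice_def by meson
  have "{..<N} \<subseteq> (\<Union>j<n. {i\<in>{..<N}. side N i \<inter> l j \<noteq> {}})"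
    using l(2) by (fastforce simp: pierced_by_def)
  then have "N \<le> card (\<Union>j<n. {i\<in>{..<N}. side N i \<inter> l j \<noteq> {}})"
    using card_mono[of "\<Union>j<n. {i\<in>{..<N}. side N i \<inter> l j \<noteq> {}}" "{..<N}"] by fastforce
  also have "\<dots> \<le> (\<Sum>j<n. card {i\<in>{..<N}. side N i \<inter> l j \<noteq> {}})"
    by (rule card_UN_le) simp
  also have "\<dots> \<le> (\<Sum>j<n. 4)"
    using l(1) assms(1) by (intro sum_mono card_sides_meeting_line_le_4) (auto simp: N_def)
  finally show ?thesis by (simp add: N_def)
qed

theorem theorem1:
  fixes k :: nat
  assumes "k \<ge> 4"
  shows "(\<exists>n. lines_suffice k n) \<and>
         \<lceil>real k / 2\<rceil> \<le> int (L k) \<and> int (L k) \<le> int k - 2"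
proof -
  have upper: "lines_suffice k (k - 2)" using assms by (rule lines_suffice_upper)
  then have "L k \<le> k - 2" unfolding L_def by (rule Least_le)
  moreover have "lines_suffice k (L k)" using upper unfolding L_def by (rule LeastI)
  then have "2 * k - 1 \<le> 4 * L k" by (rule lines_suffice_lower[OF assms])
  \<comment> \<open>Parity: \<open>4 * L k\<close> is even, so it is at least
    \<open>2 * k\<close>.\<close>
  then have "k \<le> 2 * L k" by linarith
  then have "\<lceil>real k / 2\<rceil> \<le> int (L k)" by (simp add: ceiling_le_iff)
  ultimately show ?thesis using upper assms by (intro conjI exI[of _ "k - 2"]) linarith+
qed

end
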